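(* Let $\mathcal{H}$ be a hypothesis class over a domain $\mathcal{X}$ with a compression scheme of size $k\colon \mathbb{N}\to\mathbb{N}$, let $\mathcal{L}$ be the associated compression learner, and let $\mathcal{A}\colon \mathcal{H}\to\mathcal{H}$ be any adversary. Then, given any input sample $S_L\sim_{i.i.d.}\mathcal{D}_L^n$ of size $n$ (for any distribution $\mathcal{D}_L$ over $\mathcal{X}\times\{0,1\}$), the compression learner $\mathcal{L}$ outputs a hypothesis $h$ such that with probability at least $1-\delta$ the error satisfies $err(h)\le \min_{h'\in\mathcal{H}} err(h')+\varepsilon$, and the adversary outputs a hypothesis $f=\mathcal{A}(h)$ that satisfies $|f(S_L)-f(\mathcal{D})|\le\varepsilon$, with \[\varepsilon = O\left(\sqrt{\frac{k(n)\log(n/\delta)}{n}}\right),\] as long as $n\ge 8k(n)\log(2n/\delta)$.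
   Context: A hypothesis is a map $h\colon\mathcal{X}\to\{0,1\}$; a hypothesis class is a set of hypotheses. Labelled examples lie in $\mathcal{X}_L=\mathcal{X}\times\{0,1\}$; $\mathcal{D}_L$ is a distribution over $\mathcal{X}_L$ and $\mathcal{D}$ its marginal on $\mathcal{X}$. True error: $err(h)=\Pr_{(x,y)\sim\mathcal{D}_L}[h(x)\neq y]$; empirical error on a sample $S_L$: $err(S_L,h)=\frac{1}{|S_L|}\sum_{(x_i,y_i)\in S_L}\mathbf{1}[h(x_i)\neq y_i]$. For a function $f$, $f(\mathcal{D})=\mathbb{E}_{x\sim\mathcal{D}}[f(x)]$ and $f(S_L)$ denotes the average of $f$ over the $n$ sample points. Compression scheme: $\mathcal{H}$ has a compression scheme of size $k\colon\mathbb{N}\to\mathbb{N}$ if for all $n\in\mathbb{N}$ there exist an integer $k'\le k(n)$, a compression algorithm $A\colon\mathcal{X}_L^n\to\mathcal{X}_L^{k'}$ and an encoding algorithm $B\colon\mathcal{X}_L^{k'}\to\mathcal{H}$ such that for every set $S_L$ of $n$ labelled examples, $A(S_L)=(z_{i_1},\dots,z_{i_{k'}})\in S_L^{k'}$ is a sequence of examples from $S_L$, and $h'=B(A(S_L))$ is an empirical risk minimizer, i.e. $err(S_L,h')\le err(S_L,h)$ for all $h\in\mathcal{H}$. The algorithm $\mathcal{L}=B\circ A$ is called a compression learner of size $k$ for $\mathcal{H}$.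
   Formalization: Added: each hypothesis is measurable; the maps from compressed tuple and point to the learner's and the adversary's label are jointly measurable on a set of full probability; k(n) ≥ 1; 0<δ<1. "min" is read as infimum; the O-constant is uniform over domains within one ambient type. *)

theory Defs
  imports "HOL-Probability.Probability"
begin

text \<open>
  The domain \<open>X\<close> is the underlying set of a measurable space \<open>M\<close>. The labels 0 and 1 are
  \<^const>\<open>False\<close> and \<^const>\<open>True\<close>, and the values of a hypothesis outside \<open>X\<close> play no role.
  A tuple in \<open>X\<^sub>L\<^sup>m\<close> is a function on \<open>{..<m}\<close> that is \<^const>\<open>undefined\<close> elsewhere, so that
  \<open>X\<^sub>L\<^sup>m\<close> is the underlying set of the product measurable space \<open>Pi\<^sub>M {..<m} (\<lambda>_. labelled M)\<close>.
\<close>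

type_synonym 'a hyp = "'a \<Rightarrow> bool"
type_synonym 'a lsample = "nat \<Rightarrow> 'a \<times> bool"

definition labelled :: "'a measure \<Rightarrow> ('a \<times> bool) measure" where
  "labelled M = M \<Otimes>\<^sub>M count_space UNIV"

definition lsamples :: "'a set \<Rightarrow> nat \<Rightarrow> 'a lsample set" where
  "lsamples X m = {..<m} \<rightarrow>\<^sub>E X \<times> UNIV"

definition marginal :: "'a measure \<Rightarrow> ('a \<times> bool) measure \<Rightarrow> 'a measure" where
  "marginal M DL = distr DL M fst"

definition true_err :: "('a \<times> bool) measure \<Rightarrow> 'a hyp \<Rightarrow> real" where
  "true_err DL h = measure DL {z \<in> space DL. h (fst z) \<noteq> snd z}"

definition emp_err :: "nat \<Rightarrow> 'a lsample \<Rightarrow> 'a hyp \<Rightarrow> real" where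
  "emp_err n S h = (\<Sum>i<n. of_bool (h (fst (S i)) \<noteq> snd (S i))) / real n"

definition mean :: "'a measure \<Rightarrow> 'a hyp \<Rightarrow> real" where
  "mean D f = (\<integral>x. of_bool (f x) \<partial>D)"

definition emp_mean :: "nat \<Rightarrow> 'a lsample \<Rightarrow> 'a hyp \<Rightarrow> real" where
  "emp_mean n S f = (\<Sum>i<n. of_bool (f (fst (S i)))) / real n"

text \<open>
  \<open>k'\<close>, \<open>A\<close> and \<open>B\<close> are indexed by the sample size \<open>n\<close>. A sample is a sequence, so examples may
  be repeated, both in the sample and in its compression. Sample sizes are positive.
\<close>

definition compression_scheme ::
  "'a set \<Rightarrow> 'a hyp set \<Rightarrow> (nat \<Rightarrow> nat) \<Rightarrow> (nat \<Rightarrow> nat) \<Rightarrow>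
   (nat \<Rightarrow> 'a lsample \<Rightarrow> 'a lsample) \<Rightarrow> (nat \<Rightarrow> 'a lsample \<Rightarrow> 'a hyp) \<Rightarrow> bool" where
  "compression_scheme X H k k' A B \<longleftrightarrow>
     (\<forall>n\<ge>1. k' n \<le> k n \<and>
        B n \<in> lsamples X (k' n) \<rightarrow> H \<and>
        (\<forall>S \<in> lsamples X n.
           A n S \<in> {..<k' n} \<rightarrow>\<^sub>E S ` {..<n} \<and>
           (\<forall>h\<in>H. emp_err n S (B n (A n S)) \<le> emp_err n S h)))"

definition compression_learner ::
  "(nat \<Rightarrow> 'a lsample \<Rightarrow> 'a lsample) \<Rightarrow> (nat \<Rightarrow> 'a lsample \<Rightarrow> 'a hyp) \<Rightarrow>
   nat \<Rightarrow> 'a lsample \<Rightarrow> 'a hyp" where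
  "compression_learner A B n = B n \<circ> A n"

text \<open>
  Measurability of \<open>(T, x) \<mapsto> F T x\<close> on \<open>X\<^sub>L\<^sup>m \<times> X\<close>, for hypotheses \<open>F T\<close> determined by an
  \<open>m\<close>-tuple \<open>T\<close>. Measurability of every single \<open>F T\<close> does not suffice for generalization bounds:
  take \<open>m = 1\<close> and the initial segments of a well-order of type \<open>\<omega>\<^sub>1\<close> on \<open>[0,1]\<close> (under the
  continuum hypothesis). If \<open>X\<close> is countable and discrete, every \<open>F\<close> has this property. It will
  be required only on a subspace of full measure, so that it is no restriction at all on the
  learner or the adversary when the distribution is discrete.
\<close>

definition jointly_measurable :: "'a measure \<Rightarrow> nat \<Rightarrow> ('a lsample \<Rightarrow> 'a hyp) \<Rightarrow> bool" where
  "jointly_measurable M m F \<longleftrightarrow>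
     (\<lambda>(T, x). F T x) \<in> measurable (Pi\<^sub>M {..<m} (\<lambda>_. labelled M) \<Otimes>\<^sub>M M) (count_space UNIV)"

end

theory Submission imports Defs begin

text \<open>
  The hypothesis returned by the learner is \<open>B T\<close>, where \<open>T\<close> is one of at most \<open>n ^ k'\<close>
  subtuples of the sample. For a fixed choice of indices, the examples outside \<open>T\<close> are
  independent of \<open>B T\<close> and of the adversary's answer to it, so Hoeffding's inequality bounds
  the deviation on them, and the at most \<open>k'\<close> remaining examples change an average by at most
  \<open>k' / n\<close>. A union bound over the choices of indices gives both estimates; the excess error
  is then controlled by comparing with one fixed hypothesis that is nearly optimal, since the
  infimum need not be attained.
\<close>

section \<open>Concentration for the examples outside a selected subtuple\<close>

text \<open>The coordinates are independent with common law \<open>D\<close>, so the two-sided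
  Hoeffding inequality applies. The exponent carries \<open>n\<close> instead of
  \<open>card K\<close> so that the bound is the same for all the sets \<open>K\<close> left over by
  different choices of indices.\<close>

lemma Hoeffding_PiM:
  fixes f :: "'z \<Rightarrow> real"
  assumes "prob_space D" "finite K" "card K \<le> n" "a > 0"
    and f [measurable]: "f \<in> borel_measurable D"
    and f01: "\<And>z. z \<in> space D \<Longrightarrow> 0 \<le> f z \<and> f z \<le> 1"
  shows "measure (Pi\<^sub>M K (\<lambda>_. D))
           {y \<in> space (Pi\<^sub>M K (\<lambda>_. D)). \<bar>\<Sum>i\<in>K. f (y i) - (\<integral>z. f z \<partial>D)\<bar> \<ge> a}
         \<le> 2 * exp (- 2 * a\<^sup>2 / n)"
proof (cases "K = {}")
  \<comment> \<open>The sum over the empty set is 0, so \<open>a > 0\<close> makes the event empty.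
    The criterion for independence used below needs a nonempty index set.\<close>
  case True
  then show ?thesis using \<open>a > 0\<close> by simp
next
  case False
  interpret D: prob_space D by fact
  interpret P: prob_space "Pi\<^sub>M K (\<lambda>_. D)" by (intro prob_space_PiM \<open>prob_space D\<close>)
  have distr: "distr (Pi\<^sub>M K (\<lambda>_. D)) D (\<lambda>y. y i) = D" if "i \<in> K" for i
    using distr_PiM_component[of K "\<lambda>_. D" i] that \<open>prob_space D\<close> by simp
  \<comment> \<open>Independence amounts to the joint law of the coordinates being the product of
    their marginals. Restricting to \<open>K\<close> changes nothing on this space, and each
    marginal is \<open>D\<close>.\<close>
  have "P.indep_vars (\<lambda>_. D) (\<lambda>i y. y i) K"
  proof (subst P.indep_vars_iff_distr_eq_PiM'[OF False])
    have "distr (Pi\<^sub>M K (\<lambda>_. D)) (Pi\<^sub>M K (\<lambda>_. D)) (\<lambda>x. \<lambda>i\<in>K. x i) = Pi\<^sub>M K (\<lambda>_. D)"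
      by (rule trans[OF distr_cong distr_id]) (auto simp: space_PiM)
    also have "\<dots> = Pi\<^sub>M K (\<lambda>i. distr (Pi\<^sub>M K (\<lambda>_. D)) D (\<lambda>y. y i))"
      by (intro PiM_cong refl) (simp add: distr)
    finally show "distr (Pi\<^sub>M K (\<lambda>_. D)) (Pi\<^sub>M K (\<lambda>_. D)) (\<lambda>x. \<lambda>i\<in>K. x i) = \<dots>" .
  qed simp
  then have indep: "P.indep_vars (\<lambda>_. borel) (\<lambda>i y. f (y i)) K"
    by (rule P.indep_vars_compose2) simp
  have expect: "P.expectation (\<lambda>y. f (y i)) = (\<integral>z. f z \<partial>D)" if "i \<in> K" for i
    by (subst (2) distr[OF that, symmetric], subst integral_distr) (use that in auto)
  interpret Hoeffding_ineq "Pi\<^sub>M K (\<lambda>_. D)" K "\<lambda>i y. f (y i)" "\<lambda>_. 0" "\<lambda>_. 1"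
      "real (card K) * (\<integral>z. f z \<partial>D)"
  proof unfold_locales
    show "AE y in Pi\<^sub>M K (\<lambda>_. D). f (y i) \<in> {0..1}" if "i \<in> K" for i
      using f01 that by (intro AE_I2) (auto simp: space_PiM)
    show "real (card K) * (\<integral>z. f z \<partial>D) \<equiv> \<Sum>i\<in>K. P.expectation (\<lambda>y. f (y i))"
      by (rule eq_reflection) (simp add: expect)
  qed (use \<open>finite K\<close> indep in auto)
  \<comment> \<open>Each summand ranges over an interval of length 1, so the squared lengths in
    Hoeffding's exponent add up to \<open>card K\<close>, which may then be enlarged to
    \<open>n\<close>.\<close>
  have card: "0 < card K" using False \<open>finite K\<close> by (simp add: card_gt_0_iff)
  have "P.prob {y \<in> space (Pi\<^sub>M K (\<lambda>_. D)). \<bar>\<Sum>i\<in>K. f (y i) - (\<integral>z. f z \<partial>D)\<bar> \<ge> a}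
      \<le> 2 * exp (- 2 * a\<^sup>2 / card K)"
    using Hoeffding_ineq_abs_ge[of a] \<open>a > 0\<close> card by (simp add: sum_subtractf)
  also have "\<dots> \<le> 2 * exp (- 2 * a\<^sup>2 / n)"
    using card \<open>card K \<le> n\<close> by (simp add: frac_le)
  finally show ?thesis .
qed

text \<open>
  Conditionally on the coordinates in the range of \<open>I\<close>, the function \<open>g (\<lambda>j\<in>{..<m}. S (I j))\<close>
  is fixed and the remaining coordinates are still independent, so Hoeffding's inequality applies.
\<close>

lemma Hoeffding_PiM_selected:
  fixes g :: "(nat \<Rightarrow> 'z) \<Rightarrow> 'z \<Rightarrow> real" and I :: "nat \<Rightarrow> nat"
  assumes "prob_space D" "a > 0" and I: "I \<in> {..<m} \<rightarrow> {..<n}"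
    and g [measurable]: "(\<lambda>(T, z). g T z) \<in> borel_measurable (Pi\<^sub>M {..<m} (\<lambda>_. D) \<Otimes>\<^sub>M D)"
    and g01: "\<And>T z. 0 \<le> g T z \<and> g T z \<le> 1"
  defines "T \<equiv> (\<lambda>S. \<lambda>j\<in>{..<m}. S (I j))"
  defines "Bad \<equiv> {S \<in> space (Pi\<^sub>M {..<n} (\<lambda>_. D)).
            \<bar>\<Sum>i\<in>{..<n} - I ` {..<m}. g (T S) (S i) - (\<integral>z. g (T S) z \<partial>D)\<bar> \<ge> a}"
  shows "Bad \<in> sets (Pi\<^sub>M {..<n} (\<lambda>_. D))"
    and "measure (Pi\<^sub>M {..<n} (\<lambda>_. D)) Bad \<le> 2 * exp (- 2 * a\<^sup>2 / n)"
proof -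
  interpret D: prob_space D by fact
  interpret PS: product_prob_space "\<lambda>_. D" "{..<n}" by standard
  \<comment> \<open>\<open>I\<close> need not be injective, so \<open>J\<close> may have fewer than
    \<open>m\<close> elements. The space is split as a product over \<open>J\<close> and
    \<open>K\<close>.\<close>
  define J where "J = I ` {..<m}"
  define K where "K = {..<n} - J"
  have JK: "J \<inter> K = {}" "finite J" "finite K" "J \<union> K = {..<n}"
    using I by (auto simp: J_def K_def)
  interpret PJ: prob_space "Pi\<^sub>M J (\<lambda>_. D)" by (intro prob_space_PiM D.prob_space_axioms)
  interpret PK: prob_space "Pi\<^sub>M K (\<lambda>_. D)" by (intro prob_space_PiM D.prob_space_axioms)
  have [measurable]: "T \<in> measurable (Pi\<^sub>M {..<n} (\<lambda>_. D)) (Pi\<^sub>M {..<m} (\<lambda>_. D))"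
    unfolding T_def using I by (intro measurable_restrict measurable_component_singleton) auto
  have comp: "(\<lambda>S. S i) \<in> measurable (Pi\<^sub>M {..<n} (\<lambda>_. D)) D" if "i \<in> K" for i
    using that by (auto simp: K_def intro: measurable_component_singleton)
  have sum: "(\<lambda>S. \<Sum>i\<in>K. g (T S) (S i) - (\<integral>z. g (T S) z \<partial>D)) \<in> borel_measurable (Pi\<^sub>M {..<n} (\<lambda>_. D))"
  proof (intro borel_measurable_sum borel_measurable_diff)
    fix i assume "i \<in> K"
    note comp[OF this, measurable]
    show "(\<lambda>S. g (T S) (S i)) \<in> borel_measurable (Pi\<^sub>M {..<n} (\<lambda>_. D))" by measurable
    show "(\<lambda>S. \<integral>z. g (T S) z \<partial>D) \<in> borel_measurable (Pi\<^sub>M {..<n} (\<lambda>_. D))" by measurable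
  qed
  note sum [measurable]
  show Bad: "Bad \<in> sets (Pi\<^sub>M {..<n} (\<lambda>_. D))"
    unfolding Bad_def J_def[symmetric] K_def[symmetric] by measurable
  \<comment> \<open>Fibrewise estimate: once the coordinates \<open>x\<close> in \<open>J\<close>
    are frozen, the selected tuple does not depend on \<open>y\<close>, and the section of
    \<open>Bad\<close> is a Hoeffding event for the single function \<open>h\<close>.\<close>
  have bound: "emeasure (Pi\<^sub>M K (\<lambda>_. D)) ((\<lambda>y. merge J K (x, y)) -` Bad \<inter> space (Pi\<^sub>M K (\<lambda>_. D)))
      \<le> ennreal (2 * exp (- 2 * a\<^sup>2 / n))" if x: "x \<in> space (Pi\<^sub>M J (\<lambda>_. D))" for x
  proof -
    define h where "h = g (\<lambda>j\<in>{..<m}. x (I j))"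
    have "(\<lambda>j\<in>{..<m}. x (I j)) \<in> space (Pi\<^sub>M {..<m} (\<lambda>_. D))"
      using x by (auto simp: space_PiM J_def)
    then have [measurable]: "h \<in> borel_measurable D"
      unfolding h_def by measurable
    have T: "T (merge J K (x, y)) = (\<lambda>j\<in>{..<m}. x (I j))" for y
      by (auto simp: T_def J_def merge_def)
    have "merge J K (x, y) \<in> Bad \<longleftrightarrow> a \<le> \<bar>\<Sum>i\<in>K. h (y i) - (\<integral>z. h z \<partial>D)\<bar>"
      if y: "y \<in> space (Pi\<^sub>M K (\<lambda>_. D))" for y
    proof -
      have "merge J K (x, y) \<in> space (Pi\<^sub>M (J \<union> K) (\<lambda>_. D))"
        using x y by (intro measurable_space[OF measurable_merge]) (simp add: space_pair_measure)
      moreover have "(\<Sum>i\<in>K. h (merge J K (x, y) i) - (\<integral>z. h z \<partial>D)) = (\<Sum>i\<in>K. h (y i) - (\<integral>z. h z \<partial>D))"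
        using JK(1) by (intro sum.cong refl) (auto simp: merge_def)
      ultimately show ?thesis
        unfolding Bad_def J_def[symmetric] K_def[symmetric] mem_Collect_eq T h_def[symmetric]
        by (simp add: JK)
    qed
    then have "(\<lambda>y. merge J K (x, y)) -` Bad \<inter> space (Pi\<^sub>M K (\<lambda>_. D)) =
      {y \<in> space (Pi\<^sub>M K (\<lambda>_. D)). a \<le> \<bar>\<Sum>i\<in>K. h (y i) - (\<integral>z. h z \<partial>D)\<bar>}"
      by auto
    moreover have "card K \<le> n"
      unfolding K_def using card_mono[of "{..<n}" "{..<n} - J"] by auto
    ultimately show ?thesis
      using Hoeffding_PiM[OF D.prob_space_axioms \<open>finite K\<close> \<open>card K \<le> n\<close> \<open>a > 0\<close>, of h] g01
      by (simp add: h_def[symmetric] PK.emeasure_eq_measure) (simp add: h_def ennreal_leI)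
  qed
  \<comment> \<open>Fubini: the measure of \<open>Bad\<close> is the integral of its sections, and
    the fibrewise bound is constant in \<open>x\<close>.\<close>
  have "emeasure (Pi\<^sub>M {..<n} (\<lambda>_. D)) Bad =
      (\<integral>\<^sup>+x. emeasure (Pi\<^sub>M K (\<lambda>_. D)) ((\<lambda>y. merge J K (x, y)) -` Bad \<inter> space (Pi\<^sub>M K (\<lambda>_. D))) \<partial>Pi\<^sub>M J (\<lambda>_. D))"
    using PS.emeasure_fold_integral[of J K Bad] JK Bad by simp
  also have "\<dots> \<le> (\<integral>\<^sup>+x. ennreal (2 * exp (- 2 * a\<^sup>2 / n)) \<partial>Pi\<^sub>M J (\<lambda>_. D))"
    by (intro nn_integral_mono bound)
  also have "\<dots> = ennreal (2 * exp (- 2 * a\<^sup>2 / n))"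
    by (simp add: PJ.emeasure_space_1)
  finally show "measure (Pi\<^sub>M {..<n} (\<lambda>_. D)) Bad \<le> 2 * exp (- 2 * a\<^sup>2 / n)"
    by (simp add: PS.P.emeasure_eq_measure)
qed

text \<open>Hoeffding controls only the indices outside \<open>J\<close>. Each index in
  \<open>J\<close> contributes at most 1, since \<open>f\<close> and \<open>\<mu>\<close> both lie
  in [0,1], so putting them back costs at most \<open>m / n\<close> after division.\<close>

lemma mean_deviation_le:
  fixes f :: "'z \<Rightarrow> real"
  assumes f01: "\<And>z. 0 \<le> f z \<and> f z \<le> 1" and "0 \<le> \<mu>" "\<mu> \<le> 1" "0 < n" "J \<subseteq> {..<n}" "card J \<le> m"
    and dev: "\<bar>\<Sum>i\<in>{..<n} - J. f (S i) - \<mu>\<bar> \<le> real n * t"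
  shows "\<bar>(\<Sum>i<n. f (S i)) / real n - \<mu>\<bar> \<le> t + real m / real n"
proof -
  have "finite J" using \<open>J \<subseteq> {..<n}\<close> finite_subset by blast
  have "\<bar>\<Sum>i\<in>J. f (S i) - \<mu>\<bar> \<le> (\<Sum>i\<in>J. 1)"
    by (rule order_trans[OF sum_abs sum_mono]) (use f01 assms(2,3) in \<open>smt (verit)\<close>)
  also have "\<dots> \<le> real m" using \<open>card J \<le> m\<close> by simp
  finally have J: "\<bar>\<Sum>i\<in>J. f (S i) - \<mu>\<bar> \<le> real m" .
  have "(\<Sum>i<n. f (S i)) - n * \<mu> = (\<Sum>i\<in>{..<n} - J. f (S i) - \<mu>) + (\<Sum>i\<in>J. f (S i) - \<mu>)"
    using sum.subset_diff[OF \<open>J \<subseteq> {..<n}\<close>, of "\<lambda>i. f (S i) - \<mu>"] by (simp add: sum_subtractf)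
  then have "\<bar>(\<Sum>i<n. f (S i)) - n * \<mu>\<bar> \<le> n * t + m" using J dev by linarith
  moreover have "(\<Sum>i<n. f (S i)) / real n - \<mu> = ((\<Sum>i<n. f (S i)) - n * \<mu>) / n"
    using \<open>0 < n\<close> by (simp add: field_simps)
  moreover have "t + real m / real n = (n * t + m) / n" using \<open>0 < n\<close> by (simp add: field_simps)
  ultimately show ?thesis by (simp add: divide_right_mono)
qed

section \<open>Extending joint measurability from a measurable subspace\<close>

text \<open>The tuples and points lying entirely over \<open>X\<^sub>0\<close> form a measurable set
  \<open>\<Omega>\<close>. On it the function is \<open>F\<close> composed with the identity into
  the product of the restricted spaces; off it the function is constantly
  \<open>False\<close>.\<close>

lemma jointly_measurable_extend:
  assumes [measurable]: "X\<^sub>0 \<in> sets M" and F: "jointly_measurable (restrict_space M X\<^sub>0) m F"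
  shows "(\<lambda>(T, x). (\<forall>i<m. fst (T i) \<in> X\<^sub>0) \<and> x \<in> X\<^sub>0 \<and> F T x)
    \<in> measurable (Pi\<^sub>M {..<m} (\<lambda>_. labelled M) \<Otimes>\<^sub>M M) (count_space UNIV)"
proof -
  let ?P = "Pi\<^sub>M {..<m} (\<lambda>_. labelled M) \<Otimes>\<^sub>M M"
  define \<Omega> where "\<Omega> = {(T, x). (\<forall>i<m. fst (T i :: 'a \<times> bool) \<in> X\<^sub>0) \<and> x \<in> X\<^sub>0}"
  have comp: "(\<lambda>p. fst (fst p i)) \<in> measurable ?P M" if "i \<in> {..<m}" for i
  proof (rule measurable_compose[of "\<lambda>p. fst p i" _ "labelled M" fst])
    show "(\<lambda>p. fst p i) \<in> measurable ?P (labelled M)"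
      using that by (intro measurable_compose[OF measurable_fst] measurable_component_singleton)
    show "fst \<in> measurable (labelled M) M" by (simp add: labelled_def)
  qed
  have "Measurable.pred ?P (\<lambda>p. fst (fst p i) \<in> X\<^sub>0)" if "i \<in> {..<m}" for i
    by (rule measurable_compose[OF comp[OF that], of "\<lambda>x. x \<in> X\<^sub>0"]) measurable
  then have "Measurable.pred ?P (\<lambda>p. (\<forall>i\<in>{..<m}. fst (fst p i) \<in> X\<^sub>0) \<and> snd p \<in> X\<^sub>0)"
    by (intro pred_intros_logic pred_intros_finite) auto
  then have "{p \<in> space ?P. (\<forall>i\<in>{..<m}. fst (fst p i) \<in> X\<^sub>0) \<and> snd p \<in> X\<^sub>0} \<in> sets ?P"
    by (rule predE)
  also have "{p \<in> space ?P. (\<forall>i\<in>{..<m}. fst (fst p i) \<in> X\<^sub>0) \<and> snd p \<in> X\<^sub>0} = \<Omega> \<inter> space ?P"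
    by (auto simp: \<Omega>_def)
  finally have \<Omega>: "\<Omega> \<inter> space ?P \<in> sets ?P" .
  \<comment> \<open>The identity is checked coordinate by coordinate: each map into \<open>M\<close>
    takes values in \<open>X\<^sub>0\<close> on \<open>\<Omega>\<close>, hence is measurable into
    the restricted space.\<close>
  have "(\<lambda>p. p) \<in> measurable (restrict_space ?P \<Omega>)
      (Pi\<^sub>M {..<m} (\<lambda>_. labelled (restrict_space M X\<^sub>0)) \<Otimes>\<^sub>M restrict_space M X\<^sub>0)"
  proof (rule measurable_pair)
    show "snd \<circ> (\<lambda>p. p) \<in> measurable (restrict_space ?P \<Omega>) (restrict_space M X\<^sub>0)"
      by (rule measurable_restrict_space2)
         (auto simp: space_restrict_space \<Omega>_def comp_def intro!: measurable_restrict_space1)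
    have 1: "(\<lambda>p. fst p i) \<in> measurable (restrict_space ?P \<Omega>)
        (restrict_space M X\<^sub>0 \<Otimes>\<^sub>M count_space UNIV)" if "i < m" for i
    proof (rule measurable_pair)
      show "fst \<circ> (\<lambda>p. fst p i) \<in> measurable (restrict_space ?P \<Omega>) (restrict_space M X\<^sub>0)"
        using that comp[of i] by (intro measurable_restrict_space2 measurable_restrict_space1)
         (auto simp: space_restrict_space \<Omega>_def comp_def)
      have "(\<lambda>p. fst p i) \<in> measurable ?P (labelled M)"
        using that by (intro measurable_compose[OF measurable_fst] measurable_component_singleton) simp
      then have "(\<lambda>p. snd (fst p i)) \<in> measurable ?P (count_space UNIV)"
        by (rule measurable_compose) (simp add: labelled_def)
      then show "snd \<circ> (\<lambda>p. fst p i) \<in> measurable (restrict_space ?P \<Omega>) (count_space UNIV)"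
        unfolding comp_def by (rule measurable_restrict_space1)
    qed
    show "fst \<circ> (\<lambda>p. p) \<in> measurable (restrict_space ?P \<Omega>) (Pi\<^sub>M {..<m} (\<lambda>_. labelled (restrict_space M X\<^sub>0)))"
      using 1 by (intro measurable_PiM_single')
        (auto simp: comp_def space_restrict_space space_pair_measure space_PiM labelled_def \<Omega>_def PiE_def Pi_def mem_Times_iff)
  qed
  from measurable_compose[OF this F[unfolded jointly_measurable_def]]
  have "(\<lambda>(T, x). F T x) \<in> measurable (restrict_space ?P \<Omega>) (count_space UNIV)" .
  then have "(\<lambda>p. if p \<in> \<Omega> then (\<lambda>(T, x). F T x) p else False) \<in> measurable ?P (count_space UNIV)"
    using measurable_restrict_space_iff[OF \<Omega>, of False "count_space UNIV"] by simp
  also have "(\<lambda>p. if p \<in> \<Omega> then (\<lambda>(T, x). F T x) p else False) =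
      (\<lambda>(T, x). (\<forall>i<m. fst (T i) \<in> X\<^sub>0) \<and> x \<in> X\<^sub>0 \<and> F T x)"
    by (auto simp: \<Omega>_def fun_eq_iff)
  finally show ?thesis .
qed


section \<open>Deviation bounds uniform over all choices of indices\<close>

text \<open>A union bound over the \<open>n ^ m\<close> index functions. Since one bad event serves
  all \<open>I\<close> at once, \<open>I\<close> may afterwards be chosen depending on the sample,
  as a compression algorithm does, without any measurability of that choice.\<close>

lemma uniform_deviation_selected:
  fixes g :: "(nat \<Rightarrow> 'z) \<Rightarrow> 'z \<Rightarrow> real"
  assumes "prob_space D" "t > 0" "n > 0"
    and g [measurable]: "(\<lambda>(T, z). g T z) \<in> borel_measurable (Pi\<^sub>M {..<m} (\<lambda>_. D) \<Otimes>\<^sub>M D)"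
    and g01: "\<And>T z. 0 \<le> g T z \<and> g T z \<le> 1"
  shows "\<exists>Bad \<in> sets (Pi\<^sub>M {..<n} (\<lambda>_. D)).
      measure (Pi\<^sub>M {..<n} (\<lambda>_. D)) Bad \<le> real n ^ m * (2 * exp (- 2 * real n * t\<^sup>2)) \<and>
      (\<forall>S \<in> space (Pi\<^sub>M {..<n} (\<lambda>_. D)) - Bad. \<forall>I \<in> {..<m} \<rightarrow>\<^sub>E {..<n}.
        let T = \<lambda>j\<in>{..<m}. S (I j) in
          \<bar>(\<Sum>i<n. g T (S i)) / real n - (\<integral>z. g T z \<partial>D)\<bar> \<le> t + real m / real n)"
proof -
  let ?P = "Pi\<^sub>M {..<n} (\<lambda>_. D)"
  interpret D: prob_space D by fact
  interpret P: prob_space ?P by (intro prob_space_PiM D.prob_space_axioms)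
  define bad where "bad I = {S \<in> space ?P. real n * t \<le>
      \<bar>\<Sum>i\<in>{..<n} - I ` {..<m}. g (\<lambda>j\<in>{..<m}. S (I j)) (S i) - (\<integral>z. g (\<lambda>j\<in>{..<m}. S (I j)) z \<partial>D)\<bar>}"
    for I
  let ?Is = "{..<m} \<rightarrow>\<^sub>E {..<n}"
  \<comment> \<open>The threshold \<open>n * t\<close> for the sum corresponds to \<open>t\<close>
    for the average and turns Hoeffding's exponent into \<open>- 2 * n * t^2\<close>.\<close>
  have nt: "0 < real n * t" using \<open>t > 0\<close> \<open>n > 0\<close> by simp
  have bad_sets: "bad I \<in> sets ?P" and bad_le: "P.prob (bad I) \<le> 2 * exp (- 2 * real n * t\<^sup>2)" if "I \<in> ?Is" for I
  proof -
    have I: "I \<in> {..<m} \<rightarrow> {..<n}" using that by auto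
    show "bad I \<in> sets ?P"
      unfolding bad_def by (rule Hoeffding_PiM_selected(1)[OF D.prob_space_axioms nt I g g01])
    have "P.prob (bad I) \<le> 2 * exp (- 2 * (real n * t)\<^sup>2 / real n)"
      unfolding bad_def by (rule Hoeffding_PiM_selected(2)[OF D.prob_space_axioms nt I g g01])
    also have "- 2 * (real n * t)\<^sup>2 / real n = - 2 * real n * t\<^sup>2"
      using \<open>n > 0\<close> by (simp add: power2_eq_square)
    finally show "P.prob (bad I) \<le> 2 * exp (- 2 * real n * t\<^sup>2)" .
  qed
  have fin: "finite ?Is" by (intro finite_PiE) auto
  show ?thesis
  proof (rule bexI[where x = "\<Union>I\<in>?Is. bad I"], intro conjI ballI)
    show "(\<Union>I\<in>?Is. bad I) \<in> sets ?P" using fin bad_sets by auto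
    have "P.prob (\<Union>I\<in>?Is. bad I) \<le> (\<Sum>I\<in>?Is. P.prob (bad I))"
      using fin bad_sets by (intro measure_UNION_le) auto
    also have "\<dots> \<le> (\<Sum>I\<in>?Is. 2 * exp (- 2 * real n * t\<^sup>2))" by (intro sum_mono bad_le)
    also have "\<dots> = real n ^ m * (2 * exp (- 2 * real n * t\<^sup>2))" by (simp add: card_PiE)
    finally show "P.prob (\<Union>I\<in>?Is. bad I) \<le> real n ^ m * (2 * exp (- 2 * real n * t\<^sup>2))" .
  next
    fix S I assume S: "S \<in> space ?P - (\<Union>I\<in>?Is. bad I)" and I: "I \<in> ?Is"
    define h where "h = g (\<lambda>j\<in>{..<m}. S (I j))"
    have "(\<lambda>j\<in>{..<m}. S (I j)) \<in> space (Pi\<^sub>M {..<m} (\<lambda>_. D))"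
      using S I by (auto simp: space_PiM PiE_def Pi_def)
    then have [measurable]: "h \<in> borel_measurable D" unfolding h_def by measurable
    have h01: "0 \<le> h z \<and> h z \<le> 1" for z by (simp add: h_def g01)
    have "integrable D h" by (rule D.integrable_const_bound[of _ 1]) (use h01 in auto)
    then have "0 \<le> (\<integral>z. h z \<partial>D)" "(\<integral>z. h z \<partial>D) \<le> 1"
      using h01 by (auto intro!: integral_nonneg_AE D.integral_le_const)
    then have "\<bar>(\<Sum>i<n. h (S i)) / real n - (\<integral>z. h z \<partial>D)\<bar> \<le> t + real m / real n"
      using \<open>n > 0\<close> S I h01 card_image_le[of "{..<m}" I]
      by (intro mean_deviation_le[where J = "I ` {..<m}"]) (auto simp: bad_def h_def[symmetric])
    then show "let T = \<lambda>j\<in>{..<m}. S (I j) in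
          \<bar>(\<Sum>i<n. g T (S i)) / real n - (\<integral>z. g T z \<partial>D)\<bar> \<le> t + real m / real n"
      by (simp add: h_def)
  qed
qed

text \<open>The uniform bound is applied to the 0-1 loss of \<open>F T\<close> and to the value of
  \<open>F T\<close>; the two bad events, each with factor 2, give the factor 4. Points outside
  \<open>X\<^sub>0\<close> are absorbed into a null set.\<close>

lemma hypothesis_deviation:
  fixes M :: "'a measure" and F :: "'a lsample \<Rightarrow> 'a hyp"
  assumes "prob_space DL" and sets_DL: "sets DL = sets (labelled M)"
    and X0 [measurable]: "X\<^sub>0 \<in> sets M" and full: "measure (marginal M DL) X\<^sub>0 = 1"
    and F: "jointly_measurable (restrict_space M X\<^sub>0) m F"
    and hyp: "\<And>T. T \<in> lsamples (space M) m \<Longrightarrow> F T \<in> measurable M (count_space UNIV)"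
    and "t > 0" "n > 0"
  shows "\<exists>Bad \<in> sets (Pi\<^sub>M {..<n} (\<lambda>_. DL)).
      measure (Pi\<^sub>M {..<n} (\<lambda>_. DL)) Bad \<le> 4 * real n ^ m * exp (- 2 * real n * t\<^sup>2) \<and>
      (\<forall>S \<in> space (Pi\<^sub>M {..<n} (\<lambda>_. DL)) - Bad. \<forall>I \<in> {..<m} \<rightarrow>\<^sub>E {..<n}.
        let h = F (\<lambda>j\<in>{..<m}. S (I j)) in
          \<bar>emp_err n S h - true_err DL h\<bar> \<le> t + real m / real n \<and>
          \<bar>emp_mean n S h - mean (marginal M DL) h\<bar> \<le> t + real m / real n)"
proof -
  let ?P = "Pi\<^sub>M {..<n} (\<lambda>_. DL)" and ?Q = "Pi\<^sub>M {..<m} (\<lambda>_. DL)"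
  interpret DL: prob_space DL by fact
  interpret P: prob_space ?P by (intro prob_space_PiM DL.prob_space_axioms)
  have sets_DL' [measurable_cong]: "sets DL = sets (M \<Otimes>\<^sub>M count_space UNIV)"
    using sets_DL by (simp add: labelled_def)
  have space_DL: "space DL = space M \<times> UNIV"
    using sets_eq_imp_space_eq[OF sets_DL'] by (simp add: space_pair_measure)
  have [measurable]: "fst \<in> measurable DL M" "snd \<in> measurable DL (count_space UNIV)"
    by measurable
  \<comment> \<open>Full marginal measure of \<open>X\<^sub>0\<close> passes to \<open>DL\<close>,
    then to each coordinate, then to all \<open>n\<close> coordinates together. The null set
    \<open>N\<close> contains every sample with a point outside \<open>X\<^sub>0\<close>.\<close>
  have "DL.prob {z \<in> space DL. fst z \<in> X\<^sub>0} = 1"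
    using full by (simp add: marginal_def measure_distr vimage_def Int_def conj_commute)
  then have AE_X0: "AE z in DL. fst z \<in> X\<^sub>0"
    by (subst (asm) DL.prob_eq_1) auto
  then have "AE S in ?P. fst (S i) \<in> X\<^sub>0" if "i < n" for i
    using that by (intro AE_PiM_component[where P = "\<lambda>z. fst z \<in> X\<^sub>0"] DL.prob_space_axioms) auto
  then have "AE S in ?P. \<forall>i\<in>{..<n}. fst (S i) \<in> X\<^sub>0"
    by (intro AE_finite_allI) auto
  then obtain N where N: "N \<in> sets ?P" "P.prob N = 0" "{S \<in> space ?P. \<not> (\<forall>i\<in>{..<n}. fst (S i) \<in> X\<^sub>0)} \<subseteq> N"
    by (elim AE_E) (auto simp: measure_def)

  text \<open>Replacing \<open>F\<close> by \<^const>\<open>False\<close> off \<open>X\<^sub>0\<close> makes it measurable on the whole space.\<close>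
  define G where "G T x \<longleftrightarrow> (\<forall>i<m. fst (T i) \<in> X\<^sub>0) \<and> x \<in> X\<^sub>0 \<and> F T x" for T x
  have sets_Q: "sets (?Q \<Otimes>\<^sub>M M) = sets (Pi\<^sub>M {..<m} (\<lambda>_. labelled M) \<Otimes>\<^sub>M M)"
    by (intro sets_pair_measure_cong sets_PiM_cong sets_DL refl)
  have G [measurable]: "(\<lambda>(T, x). G T x) \<in> measurable (?Q \<Otimes>\<^sub>M M) (count_space UNIV)"
    using jointly_measurable_extend[OF X0 F] unfolding G_def
    by (subst measurable_cong_sets[OF sets_Q refl])
  have [measurable]: "(\<lambda>p. G (fst p) (fst (snd p))) \<in> measurable (?Q \<Otimes>\<^sub>M DL) (count_space UNIV)"
    by measurable
  have G1: "(\<lambda>(T, z). of_bool (G T (fst z) \<noteq> snd z) :: real) \<in> borel_measurable (?Q \<Otimes>\<^sub>M DL)"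
    and G2: "(\<lambda>(T, z). of_bool (G T (fst z)) :: real) \<in> borel_measurable (?Q \<Otimes>\<^sub>M DL)"
    unfolding split_beta' by measurable
  obtain B1 where B1: "B1 \<in> sets ?P" "P.prob B1 \<le> real n ^ m * (2 * exp (- 2 * real n * t\<^sup>2))"
    "\<And>S I T. S \<in> space ?P - B1 \<Longrightarrow> I \<in> {..<m} \<rightarrow>\<^sub>E {..<n} \<Longrightarrow> T = (\<lambda>j\<in>{..<m}. S (I j)) \<Longrightarrow>
      \<bar>(\<Sum>i<n. of_bool (G T (fst (S i)) \<noteq> snd (S i))) / real n -
         (\<integral>z. of_bool (G T (fst z) \<noteq> snd z) \<partial>DL)\<bar> \<le> t + real m / real n"
    using uniform_deviation_selected[OF DL.prob_space_axioms \<open>t > 0\<close> \<open>n > 0\<close> G1] by (auto simp: Let_def)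
  obtain B2 where B2: "B2 \<in> sets ?P" "P.prob B2 \<le> real n ^ m * (2 * exp (- 2 * real n * t\<^sup>2))"
    "\<And>S I T. S \<in> space ?P - B2 \<Longrightarrow> I \<in> {..<m} \<rightarrow>\<^sub>E {..<n} \<Longrightarrow> T = (\<lambda>j\<in>{..<m}. S (I j)) \<Longrightarrow>
      \<bar>(\<Sum>i<n. of_bool (G T (fst (S i)))) / real n - (\<integral>z. of_bool (G T (fst z)) \<partial>DL)\<bar>
        \<le> t + real m / real n"
    using uniform_deviation_selected[OF DL.prob_space_axioms \<open>t > 0\<close> \<open>n > 0\<close> G2] by (auto simp: Let_def)
  show ?thesis
  proof (rule bexI[where x = "N \<union> (B1 \<union> B2)"], intro conjI ballI)
    show "N \<union> (B1 \<union> B2) \<in> sets ?P" using N B1 B2 by auto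
    have "P.prob (N \<union> (B1 \<union> B2)) \<le> P.prob N + (P.prob B1 + P.prob B2)"
      using N B1 B2 by (intro order_trans[OF measure_Un_le] add_left_mono) auto
    also have "\<dots> \<le> 4 * real n ^ m * exp (- 2 * real n * t\<^sup>2)"
      using N(2) B1(2) B2(2) by simp
    finally show "P.prob (N \<union> (B1 \<union> B2)) \<le> 4 * real n ^ m * exp (- 2 * real n * t\<^sup>2)" .
  next
    fix S I assume S: "S \<in> space ?P - (N \<union> (B1 \<union> B2))" and I: "I \<in> {..<m} \<rightarrow>\<^sub>E {..<n}"
    define T where "T = (\<lambda>j\<in>{..<m}. S (I j))"
    \<comment> \<open>Off \<open>N\<close> all sample points, hence all entries of \<open>T\<close>,
      lie over \<open>X\<^sub>0\<close>. So \<open>G T\<close> and \<open>F T\<close> agree on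
      \<open>X\<^sub>0\<close>: the empirical averages coincide exactly and the expectations because
      \<open>DL\<close> is almost surely concentrated there.\<close>
    have SX0: "fst (S i) \<in> X\<^sub>0" if "i < n" for i using S N(3) that by auto
    have "T \<in> lsamples (space M) m"
      using S I by (auto simp: T_def lsamples_def space_PiM space_DL PiE_def Pi_def)
    note hyp[OF this, measurable]
    have "fst (T j) \<in> X\<^sub>0" if "j < m" for j using that I SX0 by (auto simp: T_def)
    then have GT: "G T x \<longleftrightarrow> F T x" if "x \<in> X\<^sub>0" for x using that by (auto simp: G_def)
    have "Measurable.pred DL (\<lambda>z. G T (fst z))"
    proof -
      have [measurable]: "T \<in> space ?Q"
        using S I by (auto simp: T_def space_PiM PiE_def Pi_def)
      show ?thesis by measurable
    qed
    note this [measurable]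
    have "(\<integral>z. of_bool (G T (fst z) \<noteq> snd z) \<partial>DL) = (\<integral>z. indicator {z \<in> space DL. F T (fst z) \<noteq> snd z} z \<partial>DL)"
      by (rule integral_cong_AE) (use AE_X0 in \<open>auto simp: GT elim!: AE_mp\<close>)
    also have "\<dots> = true_err DL (F T)" by (simp add: true_err_def)
    finally have 1: "(\<integral>z. of_bool (G T (fst z) \<noteq> snd z) \<partial>DL) = true_err DL (F T)" .
    have "(\<integral>z. of_bool (G T (fst z)) \<partial>DL) = (\<integral>z. of_bool (F T (fst z)) \<partial>DL)"
      by (rule integral_cong_AE) (use AE_X0 in \<open>auto simp: GT elim!: AE_mp\<close>)
    also have "\<dots> = mean (marginal M DL) (F T)"
      unfolding mean_def marginal_def by (subst integral_distr) auto
    finally have 2: "(\<integral>z. of_bool (G T (fst z)) \<partial>DL) = mean (marginal M DL) (F T)" .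
    have 3: "(\<Sum>i<n. of_bool (G T (fst (S i)) \<noteq> snd (S i))) / real n = emp_err n S (F T)"
      "(\<Sum>i<n. of_bool (G T (fst (S i)))) / real n = emp_mean n S (F T)"
      unfolding emp_err_def emp_mean_def
      by (auto intro!: arg_cong2[where f = "(/)"] sum.cong simp: GT SX0 simp del: sum_of_bool_eq)
    show "let h = F (\<lambda>j\<in>{..<m}. S (I j)) in
          \<bar>emp_err n S h - true_err DL h\<bar> \<le> t + real m / real n \<and>
          \<bar>emp_mean n S h - mean (marginal M DL) h\<bar> \<le> t + real m / real n"
      using B1(3)[OF _ I T_def] B2(3)[OF _ I T_def] S unfolding 1 2 3 T_def[symmetric] by (simp add: Let_def)
  qed
qed

section \<open>Numerical consequences of the sample size condition\<close>

text \<open>By the choice of \<open>s\<close>, the exponential equals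
  \<open>(\<delta> / n) ^ (2 * k)\<close>, which beats the \<open>n ^ k\<close> index choices with a
  factor \<open>n ^ k\<close> to spare. The constant 12 accounts for three bad events with factor 4
  each.\<close>

lemma sample_size_bounds:
  fixes \<delta> :: real
  assumes "n \<ge> 1" "k \<ge> 1" "0 < \<delta>" "\<delta> < 1" and n: "real n \<ge> 8 * real k * ln (2 * real n / \<delta>)"
  defines "s \<equiv> sqrt (real k * ln (real n / \<delta>) / real n)"
  shows "0 < s" "real k / real n \<le> s" "12 * real n ^ k * exp (- 2 * real n * s\<^sup>2) \<le> \<delta>"
proof -
  let ?L = "ln (real n / \<delta>)"
  have quot: "x \<le> x / \<delta>" if "0 \<le> x" for x
    using that assms(3,4) by (simp add: pos_le_divide_eq mult_left_le)
  \<comment> \<open>A bootstrap: a lower bound \<open>c\<close> on \<open>ln (2 * n)\<close> yields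
    \<open>n \<ge> 8 * c\<close>. Starting from 1/2 it gives \<open>n \<ge> 4\<close>; then
    \<open>2 * n\<close> exceeds the square of e, so \<open>c = 2\<close> gives
    \<open>n \<ge> 16\<close>.\<close>
  have ge: "8 * c \<le> real n" if "0 \<le> c" "c \<le> ln (2 * real n)" for c
  proof -
    have "ln (2 * real n) \<le> ln (2 * real n / \<delta>)"
      using quot[of "2 * real n"] \<open>n \<ge> 1\<close> by (subst ln_le_cancel_iff) (use assms in auto)
    then have "1 * c \<le> real k * ln (2 * real n / \<delta>)"
      using that \<open>k \<ge> 1\<close> by (intro mult_mono) auto
    then show ?thesis using n by linarith
  qed
  have "1 / 2 \<le> ln (2 :: real)" using ln2_ge_two_thirds by simp
  also have "\<dots> \<le> ln (2 * real n)" using \<open>n \<ge> 1\<close> by simp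
  finally have "4 \<le> real n" using ge[of "1 / 2"] by simp
  have "exp (2 :: real) = exp 1 * exp 1" by (simp flip: exp_add)
  also have "\<dots> \<le> 272 / 100 * (272 / 100)" using e_less_272 by (intro mult_mono) auto
  also have "\<dots> \<le> 2 * real n" using \<open>4 \<le> real n\<close> by simp
  finally have "2 \<le> ln (2 * real n)" using \<open>n \<ge> 1\<close> by (subst ln_ge_iff) auto
  then have n16: "16 \<le> real n" using ge[of 2] by simp
  have "exp 1 \<le> real n / \<delta>" using quot[of "real n"] n16 e_less_272 by linarith
  then have L: "1 \<le> ?L" using n16 assms by (subst ln_ge_iff) auto
  then show "0 < s" using n16 \<open>k \<ge> 1\<close> unfolding s_def by (intro real_sqrt_gt_zero divide_pos_pos mult_pos_pos) auto
  have "?L \<le> ln (2 * real n / \<delta>)" using n16 assms by (intro ln_mono divide_right_mono) auto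
  then have "real k * 1 \<le> real k * ln (2 * real n / \<delta>)" using L by (intro mult_left_mono) auto
  then have "real k \<le> real n" using n by linarith
  \<comment> \<open>As \<open>k / n \<le> 1 \<le> ?L\<close>, the square of \<open>k / n\<close> is
    at most \<open>(k / n) * ?L\<close>, which is the square of \<open>s\<close>.\<close>
  then have "real k / real n \<le> ?L" using L n16 by (intro order_trans[OF _ L]) simp
  then have "(real k / real n) * (real k / real n) \<le> (real k / real n) * ?L"
    by (intro mult_left_mono) auto
  then show "real k / real n \<le> s"
    unfolding s_def by (intro real_le_rsqrt) (simp add: power2_eq_square)
  have "real n * s\<^sup>2 = real k * ?L" using n16 L by (simp add: s_def)
  then have "exp (- 2 * real n * s\<^sup>2) = exp (real (2 * k) * - ?L)" by (simp add: algebra_simps)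
  also have "\<dots> = (\<delta> / real n) ^ (2 * k)"
    using n16 assms by (simp only: exp_of_nat_mult) (simp add: exp_minus)
  \<comment> \<open>Since \<open>\<delta> < 1\<close> and \<open>k \<ge> 1\<close>, the power
    \<open>\<delta> ^ (2 * k)\<close> is at most \<open>\<delta>\<close>.\<close>
  also have "\<dots> \<le> (\<delta> / real n ^ (2 * k))"
    using assms power_decreasing[of 1 "2 * k" \<delta>] by (simp add: power_divide divide_right_mono)
  finally have "12 * real n ^ k * exp (- 2 * real n * s\<^sup>2) \<le> 12 * real n ^ k * (\<delta> / real n ^ (2 * k))"
    by (intro mult_left_mono) auto
  also have "\<dots> = \<delta> * (12 / real n ^ k)"
    using n16 by (simp add: mult_2 power_add)
  also have "\<dots> \<le> \<delta> * 1"
  proof (intro mult_left_mono)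
    have "real n ^ 1 \<le> real n ^ k" using n16 \<open>k \<ge> 1\<close> by (intro power_increasing) auto
    then have "12 \<le> real n ^ k" using n16 by (simp only: power_one_right)
    then show "12 / real n ^ k \<le> 1" by (simp only: divide_le_eq_1) auto
  qed (use assms in auto)
  finally show "12 * real n ^ k * exp (- 2 * real n * s\<^sup>2) \<le> \<delta>" by simp
qed


section \<open>Generalization of the learner and of the adversary's answer\<close>

theorem theorem3p6:
  "\<exists>C::real. C > 0 \<and>
    (\<forall>(M :: 'a measure) (H :: 'a hyp set) (k :: nat \<Rightarrow> nat) (k' :: nat \<Rightarrow> nat)
      (A :: nat \<Rightarrow> 'a lsample \<Rightarrow> 'a lsample) (B :: nat \<Rightarrow> 'a lsample \<Rightarrow> 'a hyp)
      (adv :: 'a hyp \<Rightarrow> 'a hyp) (DL :: ('a \<times> bool) measure) (X\<^sub>0 :: 'a set) (n :: nat) (\<delta> :: real) (\<epsilon> :: real).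
      (\<forall>h\<in>H. h \<in> measurable M (count_space UNIV)) \<longrightarrow>
      (\<forall>m\<ge>1. k m \<ge> 1) \<longrightarrow>
      compression_scheme (space M) H k k' A B \<longrightarrow>
      adv \<in> H \<rightarrow> H \<longrightarrow>
      prob_space DL \<longrightarrow>
      sets DL = sets (labelled M) \<longrightarrow>
      n \<ge> 1 \<longrightarrow>
      X\<^sub>0 \<in> sets M \<longrightarrow> measure (marginal M DL) X\<^sub>0 = 1 \<longrightarrow>
      jointly_measurable (restrict_space M X\<^sub>0) (k' n) (B n) \<longrightarrow>
      jointly_measurable (restrict_space M X\<^sub>0) (k' n) (adv \<circ> B n) \<longrightarrow>
      0 < \<delta> \<longrightarrow> \<delta> < 1 \<longrightarrow>
      real n \<ge> 8 * real (k n) * ln (2 * real n / \<delta>) \<longrightarrow>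
      \<epsilon> = C * sqrt (real (k n) * ln (real n / \<delta>) / real n) \<longrightarrow>
      (\<exists>E \<in> sets (Pi\<^sub>M {..<n} (\<lambda>_. DL)).
         measure (Pi\<^sub>M {..<n} (\<lambda>_. DL)) E \<ge> 1 - \<delta> \<and>
         (\<forall>S\<in>E.
            let h = compression_learner A B n S; f = adv h in
              true_err DL h \<le> (INF h'\<in>H. true_err DL h') + \<epsilon> \<and>
              \<bar>emp_mean n S f - mean (marginal M DL) f\<bar> \<le> \<epsilon>)))"
proof (intro exI[of _ 4] conjI allI impI)
  fix M :: "'a measure" and H :: "'a hyp set" and k k' :: "nat \<Rightarrow> nat"
    and A :: "nat \<Rightarrow> 'a lsample \<Rightarrow> 'a lsample" and B :: "nat \<Rightarrow> 'a lsample \<Rightarrow> 'a hyp"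
    and adv :: "'a hyp \<Rightarrow> 'a hyp" and DL :: "('a \<times> bool) measure" and X\<^sub>0 :: "'a set"
    and n :: nat and \<delta> \<epsilon> :: real
  assume H: "\<forall>h\<in>H. h \<in> measurable M (count_space UNIV)" and k: "\<forall>m\<ge>1. k m \<ge> 1"
    and scheme: "compression_scheme (space M) H k k' A B" and adv: "adv \<in> H \<rightarrow> H"
    and DL: "prob_space DL" and sets_DL: "sets DL = sets (labelled M)" and n: "n \<ge> 1"
    and X0: "X\<^sub>0 \<in> sets M" and full: "measure (marginal M DL) X\<^sub>0 = 1"
    and jmB: "jointly_measurable (restrict_space M X\<^sub>0) (k' n) (B n)"
    and jma: "jointly_measurable (restrict_space M X\<^sub>0) (k' n) (adv \<circ> B n)"
    and \<delta>: "0 < \<delta>" "\<delta> < 1" and size: "real n \<ge> 8 * real (k n) * ln (2 * real n / \<delta>)"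
    and \<epsilon>: "\<epsilon> = 4 * sqrt (real (k n) * ln (real n / \<delta>) / real n)"
  let ?P = "Pi\<^sub>M {..<n} (\<lambda>_. DL)"
  interpret DL: prob_space DL by fact
  interpret P: prob_space ?P by (intro prob_space_PiM DL.prob_space_axioms)
  \<comment> \<open>\<open>s\<close> is a quarter of \<open>\<epsilon>\<close>. The excess error
    uses all four quarters: two for the learner's deviation, one for the deviation of a comparison
    hypothesis, and one for its distance from the infimum.\<close>
  define s where "s = sqrt (real (k n) * ln (real n / \<delta>) / real n)"
  have "k n \<ge> 1" using k n by blast
  note s = sample_size_bounds[OF n this \<delta> size, folded s_def]
  have "n > 0" using n by simp
  have k': "k' n \<le> k n" and B: "B n \<in> lsamples (space M) (k' n) \<rightarrow> H"
    using scheme n by (auto simp: compression_scheme_def)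
  have A: "A n S \<in> {..<k' n} \<rightarrow>\<^sub>E S ` {..<n}"
    and erm: "\<And>h. h \<in> H \<Longrightarrow> emp_err n S (B n (A n S)) \<le> emp_err n S h"
    if "S \<in> lsamples (space M) n" for S
    using scheme n that by (auto simp: compression_scheme_def)
  have space_DL: "space DL = space M \<times> UNIV"
    using sets_eq_imp_space_eq[OF sets_DL] by (simp add: labelled_def space_pair_measure)
  \<comment> \<open>Any constant tuple is mapped into \<open>H\<close> by \<open>B n\<close>.
    Together with the lower bound 0 on errors this makes the infimum meaningful and, as
    \<open>s > 0\<close>, approachable within \<open>s\<close>.\<close>
  have "H \<noteq> {}"
  proof -
    obtain z where "z \<in> space DL" using DL.not_empty by blast
    then have "(\<lambda>j\<in>{..<k' n}. z) \<in> lsamples (space M) (k' n)"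
      by (auto simp: lsamples_def space_DL)
    with B show ?thesis by blast
  qed
  moreover have "bdd_below (true_err DL ` H)"
    by (intro bdd_belowI[of _ 0]) (auto simp: true_err_def)
  ultimately obtain h\<^sub>0 where h0: "h\<^sub>0 \<in> H" "true_err DL h\<^sub>0 < (INF h\<in>H. true_err DL h) + s"
    using cINF_less_iff[of H "true_err DL" "(INF h\<in>H. true_err DL h) + s"] s(1) by auto
  \<comment> \<open>The fixed hypothesis is a family indexed by the empty tuple. With
    \<open>m = 0\<close> there is one choice of indices and no correction term.\<close>
  have jm0: "jointly_measurable (restrict_space M X\<^sub>0) 0 (\<lambda>_. h\<^sub>0)"
  proof -
    have [measurable]: "h\<^sub>0 \<in> measurable (restrict_space M X\<^sub>0) (count_space UNIV)"
      using H h0(1) by (intro measurable_restrict_space1) blast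
    show ?thesis unfolding jointly_measurable_def by measurable
  qed
  have "\<exists>E0 \<in> sets ?P. P.prob E0 \<le> 4 * real n ^ 0 * exp (- 2 * real n * s\<^sup>2) \<and>
      (\<forall>S \<in> space ?P - E0. \<forall>I \<in> {..<0} \<rightarrow>\<^sub>E {..<n}.
        let h = h\<^sub>0 in \<bar>emp_err n S h - true_err DL h\<bar> \<le> s + real 0 / real n \<and>
          \<bar>emp_mean n S h - mean (marginal M DL) h\<bar> \<le> s + real 0 / real n)"
    using hypothesis_deviation[OF DL sets_DL X0 full jm0 _ s(1) \<open>n > 0\<close>] H h0(1) by auto
  then obtain E0 where E0: "E0 \<in> sets ?P" "P.prob E0 \<le> 4 * exp (- 2 * real n * s\<^sup>2)"
      "\<And>S. S \<in> space ?P - E0 \<Longrightarrow> \<bar>emp_err n S h\<^sub>0 - true_err DL h\<^sub>0\<bar> \<le> s"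
    by (fastforce simp: Let_def)
  obtain E1 where E1: "E1 \<in> sets ?P" "P.prob E1 \<le> 4 * real n ^ k' n * exp (- 2 * real n * s\<^sup>2)"
      "\<And>S I h. S \<in> space ?P - E1 \<Longrightarrow> I \<in> {..<k' n} \<rightarrow>\<^sub>E {..<n} \<Longrightarrow> h = B n (\<lambda>j\<in>{..<k' n}. S (I j)) \<Longrightarrow>
        \<bar>emp_err n S h - true_err DL h\<bar> \<le> s + real (k' n) / real n"
    using hypothesis_deviation[OF DL sets_DL X0 full jmB _ s(1) \<open>n > 0\<close>] H B
    by (auto simp: Let_def Pi_iff)
  \<comment> \<open>The adversary sees only the learner's output, so its answer is also determined
    by the compressed tuple and the same union bound covers it.\<close>
  obtain E2 where E2: "E2 \<in> sets ?P" "P.prob E2 \<le> 4 * real n ^ k' n * exp (- 2 * real n * s\<^sup>2)"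
      "\<And>S I h. S \<in> space ?P - E2 \<Longrightarrow> I \<in> {..<k' n} \<rightarrow>\<^sub>E {..<n} \<Longrightarrow> h = adv (B n (\<lambda>j\<in>{..<k' n}. S (I j))) \<Longrightarrow>
        \<bar>emp_mean n S h - mean (marginal M DL) h\<bar> \<le> s + real (k' n) / real n"
    using hypothesis_deviation[OF DL sets_DL X0 full jma _ s(1) \<open>n > 0\<close>] H B adv
    by (auto simp: Let_def Pi_iff)
  have gap: "s + real (k' n) / real n \<le> 2 * s"
  proof -
    have "real (k' n) / real n \<le> real (k n) / real n" using k' by (simp add: divide_right_mono)
    then show ?thesis using s(2) by linarith
  qed
  let ?Bad = "E0 \<union> (E1 \<union> E2)"
  show "\<exists>E \<in> sets ?P. P.prob E \<ge> 1 - \<delta> \<and>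
         (\<forall>S\<in>E.
            let h = compression_learner A B n S; f = adv h in
              true_err DL h \<le> (INF h'\<in>H. true_err DL h') + \<epsilon> \<and>
              \<bar>emp_mean n S f - mean (marginal M DL) f\<bar> \<le> \<epsilon>)"
  proof (rule bexI[where x = "space ?P - ?Bad"], intro conjI ballI)
    show "space ?P - ?Bad \<in> sets ?P" using E0 E1 E2 by auto
    have "P.prob ?Bad \<le> P.prob E0 + (P.prob E1 + P.prob E2)"
      using E0 E1 E2 by (intro order_trans[OF measure_Un_le] add_left_mono) auto
    also have "\<dots> \<le> 4 * real n ^ k n * exp (- 2 * real n * s\<^sup>2) +
        (4 * real n ^ k n * exp (- 2 * real n * s\<^sup>2) + 4 * real n ^ k n * exp (- 2 * real n * s\<^sup>2))"
    proof (intro add_mono)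
      have pow: "real n ^ k' n \<le> real n ^ k n" using n k' by (intro power_increasing) auto
      then have *: "4 * real n ^ k' n * exp (- 2 * real n * s\<^sup>2) \<le> 4 * real n ^ k n * exp (- 2 * real n * s\<^sup>2)"
        by simp
      show "P.prob E1 \<le> 4 * real n ^ k n * exp (- 2 * real n * s\<^sup>2)"
        and "P.prob E2 \<le> 4 * real n ^ k n * exp (- 2 * real n * s\<^sup>2)"
        using E1(2) E2(2) * by linarith+
      \<comment> \<open>The bound for \<open>E0\<close> is enlarged to match the other two, so that
        the three add up to the constant 12.\<close>
      have "1 \<le> real n ^ k n" using n by simp
      then have "4 * exp (- 2 * real n * s\<^sup>2) \<le> 4 * real n ^ k n * exp (- 2 * real n * s\<^sup>2)"
        by simp
      then show "P.prob E0 \<le> 4 * real n ^ k n * exp (- 2 * real n * s\<^sup>2)"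
        using E0(2) by linarith
    qed
    also have "\<dots> \<le> \<delta>" using s(3) by simp
    finally show "P.prob (space ?P - ?Bad) \<ge> 1 - \<delta>"
      using E0 E1 E2 by (subst P.prob_compl) auto
  next
    fix S assume S: "S \<in> space ?P - ?Bad"
    have "S \<in> lsamples (space M) n"
      using S by (simp add: space_PiM lsamples_def space_DL)
    note AS = A[OF this] and ermS = erm[OF this h0(1)]
    \<comment> \<open>Every compressed example occurs in the sample; choosing one position for each
      exhibits \<open>A n S\<close> as a selected subtuple, to which the uniform bounds
      apply.\<close>
    define I where "I = (\<lambda>j\<in>{..<k' n}. SOME i. i < n \<and> S i = A n S j)"
    have "I j < n \<and> S (I j) = A n S j" if "j < k' n" for j
    proof -
      have "A n S j \<in> S ` {..<n}" using AS that by auto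
      then have "\<exists>i. i < n \<and> S i = A n S j" by auto
      from someI_ex[OF this] show ?thesis using that by (simp add: I_def)
    qed
    then have I: "I \<in> {..<k' n} \<rightarrow>\<^sub>E {..<n}" and AS_eq: "A n S = (\<lambda>j\<in>{..<k' n}. S (I j))"
      using AS by (auto simp: I_def fun_eq_iff PiE_def extensional_def)
    have "\<bar>emp_err n S (B n (A n S)) - true_err DL (B n (A n S))\<bar> \<le> 2 * s"
      using E1(3)[OF _ I] S gap unfolding AS_eq by fastforce
    moreover have "\<bar>emp_err n S h\<^sub>0 - true_err DL h\<^sub>0\<bar> \<le> s" using E0(3) S by blast
    moreover have "\<bar>emp_mean n S (adv (B n (A n S))) - mean (marginal M DL) (adv (B n (A n S)))\<bar> \<le> 2 * s"
      using E2(3)[OF _ I] S gap unfolding AS_eq by fastforce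
    moreover have "\<epsilon> = 4 * s" by (simp add: \<epsilon> s_def)
    \<comment> \<open>With \<open>h\<close> the learner's output: its true error is at most its
      empirical error plus \<open>2 * s\<close>, hence at most that of \<open>h\<^sub>0\<close> plus
      \<open>2 * s\<close>, hence at most the true error of \<open>h\<^sub>0\<close> plus
      \<open>3 * s\<close>, which lies below the infimum plus \<open>4 * s\<close>.\<close>
    ultimately show "let h = compression_learner A B n S; f = adv h in
              true_err DL h \<le> (INF h'\<in>H. true_err DL h') + \<epsilon> \<and>
              \<bar>emp_mean n S f - mean (marginal M DL) f\<bar> \<le> \<epsilon>"
      using ermS h0(2) s(1) by (simp add: compression_learner_def Let_def)
  qed
qed simp

end
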